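(* Let $v\in \mathcal{C}^2(\mathbb{H})$ and let $q\in\mathbb{H}$. If $\nabla_{\mathbb{H}}v(q)\neq 0$, then as $r\to 0+$: $$\frac12\Big(\inf_{B_r(q)}v+\sup_{B_r(q)}v\Big)=v(q)+\frac{r^2}{2}\Delta_{\mathbb{H},\infty}v(q)+o(r^2).$$
   Context: $\mathbb{H}=(\mathbb{R}^3,* )$ is the first Heisenberg group with $(x,y,z)*(x',y',z')=(x+x',y+y',z+z'+\frac12(xy'-yx'))$. The Korányi gauge is $|(x,y,z)|_K=((x^2+y^2)^2+16z^2)^{1/4}$, the metric is $d(q,q')=|q^{-1}*q'|_K$, and $B_r(q)=\{q'\in\mathbb{H}: d(q,q')<r\}$. With $X=\partial_x-\frac y2\partial_z$, $Y=\partial_y+\frac x2\partial_z$, the horizontal gradient is $\nabla_{\mathbb{H}}v=(Xv,Yv)$ and $\nabla^2_{\mathbb{H}}v$ is the $2\times2$ matrix of second horizontal derivatives (entries $XXv, XYv, YXv, YYv$). Where $\nabla_{\mathbb{H}}v\ne0$, the $\infty$-sub-Laplacian is $\Delta_{\mathbb{H},\infty}v=\big\langle\nabla^2_{\mathbb{H}}v:\big(\frac{\nabla_{\mathbb{H}}v}{|\nabla_{\mathbb{H}}v|}\big)^{\otimes2}\big\rangle$, where $\langle A:B\rangle=\sum_{ij}A_{ij}B_{ij}$ and $w^{\otimes 2}=w\otimes w$. *)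

theory Defs
  imports "HOL-Analysis.Analysis" "HOL-Library.Landau_Symbols"
begin

type_synonym heis = "real \<times> real \<times> real"

definition heis_mult :: "heis \<Rightarrow> heis \<Rightarrow> heis" where
  "heis_mult = (\<lambda>(x, y, z) (x', y', z'). (x + x', y + y', z + z' + (x * y' - y * x') / 2))"

definition heis_inv :: "heis \<Rightarrow> heis" where
  "heis_inv = (\<lambda>(x, y, z). (- x, - y, - z))"

lemma heis_inv_left: "heis_mult (heis_inv q) q = (0, 0, 0)"
  and heis_inv_right: "heis_mult q (heis_inv q) = (0, 0, 0)"
  by (auto simp: heis_mult_def heis_inv_def split: prod.splits)

definition koranyi_gauge :: "heis \<Rightarrow> real" where
  "koranyi_gauge = (\<lambda>(x, y, z). root 4 ((x\<^sup>2 + y\<^sup>2)\<^sup>2 + 16 * z\<^sup>2))"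

definition heis_dist :: "heis \<Rightarrow> heis \<Rightarrow> real" where
  "heis_dist q q' = koranyi_gauge (heis_mult (heis_inv q) q')"

definition heis_ball :: "real \<Rightarrow> heis \<Rightarrow> heis set" where
  "heis_ball r q = {q'. heis_dist q q' < r}"

text \<open>Coefficient vectors of the fields \<open>X = \<partial>\<^sub>x - (y/2) \<partial>\<^sub>z\<close> and \<open>Y = \<partial>\<^sub>y + (x/2) \<partial>\<^sub>z\<close>.\<close>

definition X_field :: "heis \<Rightarrow> heis" where
  "X_field = (\<lambda>(x, y, z). (1, 0, - (y / 2)))"

definition Y_field :: "heis \<Rightarrow> heis" where
  "Y_field = (\<lambda>(x, y, z). (0, 1, x / 2))"

text \<open>A vector field acts on functions as the directional derivative along its coefficient vector.
  The line \<open>t \<mapsto> q + t W(q)\<close> is, for \<open>W = X\<close> and \<open>W = Y\<close>, also the integral curve through \<open>q\<close>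
  (see \<open>X_line\<close>, \<open>Y_line\<close>), so this derivative needs no Euclidean differentiability.  Where \<open>v\<close> is
  differentiable it is the usual combination of partial derivatives
  (\<open>dX_partials\<close>, \<open>dY_partials\<close>).\<close>

definition field_deriv :: "(heis \<Rightarrow> heis) \<Rightarrow> (heis \<Rightarrow> real) \<Rightarrow> heis \<Rightarrow> real" where
  "field_deriv W v q = deriv (\<lambda>t. v (q + t *\<^sub>R W q)) 0"

abbreviation dX :: "(heis \<Rightarrow> real) \<Rightarrow> heis \<Rightarrow> real" where
  "dX \<equiv> field_deriv X_field"

abbreviation dY :: "(heis \<Rightarrow> real) \<Rightarrow> heis \<Rightarrow> real" where
  "dY \<equiv> field_deriv Y_field"

definition heis_C1 :: "(heis \<Rightarrow> real) \<Rightarrow> bool" where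
  "heis_C1 v \<longleftrightarrow> continuous_on UNIV v \<and>
     (\<forall>q. (\<lambda>t::real. v (q + t *\<^sub>R X_field q)) differentiable (at 0)) \<and>
     (\<forall>q. (\<lambda>t::real. v (q + t *\<^sub>R Y_field q)) differentiable (at 0)) \<and>
     continuous_on UNIV (dX v) \<and> continuous_on UNIV (dY v)"

text \<open>The class \<open>C\<^sup>2\<close> on the group: the horizontal derivatives up to order two exist
  and are continuous.  It contains every function that is twice continuously differentiable on
  \<open>\<real>\<^sup>3\<close> in the Euclidean sense (\<open>heis_C2_if_euclidean_C2\<close>).\<close>

definition heis_C2 :: "(heis \<Rightarrow> real) \<Rightarrow> bool" where
  "heis_C2 v \<longleftrightarrow> heis_C1 v \<and> heis_C1 (dX v) \<and> heis_C1 (dY v)"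

definition horiz_grad :: "(heis \<Rightarrow> real) \<Rightarrow> heis \<Rightarrow> real ^ 2" where
  "horiz_grad v q = vector [dX v q, dY v q]"

definition horiz_hess :: "(heis \<Rightarrow> real) \<Rightarrow> heis \<Rightarrow> real ^ 2 ^ 2" where
  "horiz_hess v q =
     vector [vector [dX (dX v) q, dX (dY v) q],
             vector [dY (dX v) q, dY (dY v) q]]"

definition tensor_square :: "real ^ 2 \<Rightarrow> real ^ 2 ^ 2" where
  "tensor_square w = (\<chi> i j. w $ i * w $ j)"

text \<open>The inner product of \<^typ>\<open>real ^ 2 ^ 2\<close> is the entrywise pairing
  \<open>\<Sum>\<^sub>i\<^sub>j A\<^sub>i\<^sub>j B\<^sub>i\<^sub>j\<close>.  The value is meaningful only where the horizontal gradient is nonzero.\<close>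

definition inf_sub_Laplacian :: "(heis \<Rightarrow> real) \<Rightarrow> heis \<Rightarrow> real" where
  "inf_sub_Laplacian v q =
     horiz_hess v q \<bullet> tensor_square (horiz_grad v q /\<^sub>R norm (horiz_grad v q))"

lemma X_line: "q + t *\<^sub>R X_field q = heis_mult q (t, 0, 0)"
  and Y_line: "q + t *\<^sub>R Y_field q = heis_mult q (0, t, 0)"
  by (auto simp: heis_mult_def X_field_def Y_field_def split: prod.splits)

lemma field_deriv_line:
  assumes "(v has_derivative v') (at q)"
  shows "((\<lambda>t. v (q + t *\<^sub>R W q)) has_real_derivative v' (W q)) (at 0)"
proof -
  have lin: "linear v'" using assms by (rule has_derivative_linear)
  have "((\<lambda>t::real. q + t *\<^sub>R W q) has_derivative (\<lambda>t. t *\<^sub>R W q)) (at 0)"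
    by (auto intro!: derivative_eq_intros)
  from has_derivative_compose[OF this, of v v'] assms
  have "((\<lambda>t. v (q + t *\<^sub>R W q)) has_derivative (\<lambda>t. v' (t *\<^sub>R W q))) (at 0)" by simp
  moreover have "(\<lambda>t. v' (t *\<^sub>R W q)) = (*) (v' (W q))"
    by (auto simp: linear_scale[OF lin] mult.commute)
  ultimately show ?thesis by (simp add: has_field_derivative_def)
qed

lemma field_deriv_eq:
  assumes "(v has_derivative v') (at q)"
  shows "field_deriv W v q = v' (W q)"
  unfolding field_deriv_def by (rule DERIV_imp_deriv[OF field_deriv_line[OF assms]])

lemma partial_eq:
  assumes "(v has_derivative v') (at ((x, y, z) :: heis))"
  shows "deriv (\<lambda>s. v (s, y, z)) x = v' (1, 0, 0)"
    and "deriv (\<lambda>s. v (x, s, z)) y = v' (0, 1, 0)"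
    and "deriv (\<lambda>s. v (x, y, s)) z = v' (0, 0, 1)"
proof -
  have shift: "deriv f a = deriv (\<lambda>t. f (a + t)) 0" for f :: "real \<Rightarrow> real" and a
    unfolding deriv_def using DERIV_at_within_shift[of f _ a 0 UNIV] by simp
  show "deriv (\<lambda>s. v (s, y, z)) x = v' (1, 0, 0)"
    using field_deriv_eq[OF assms, of "\<lambda>_. (1, 0, 0)"] by (simp add: field_deriv_def shift[of _ x])
  show "deriv (\<lambda>s. v (x, s, z)) y = v' (0, 1, 0)"
    using field_deriv_eq[OF assms, of "\<lambda>_. (0, 1, 0)"] by (simp add: field_deriv_def shift[of _ y])
  show "deriv (\<lambda>s. v (x, y, s)) z = v' (0, 0, 1)"
    using field_deriv_eq[OF assms, of "\<lambda>_. (0, 0, 1)"] by (simp add: field_deriv_def shift[of _ z])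
qed

lemma
  assumes "v differentiable (at ((x, y, z) :: heis))"
  shows dX_partials: "dX v (x, y, z) =
      deriv (\<lambda>s. v (s, y, z)) x - y / 2 * deriv (\<lambda>s. v (x, y, s)) z"
    and dY_partials: "dY v (x, y, z) =
      deriv (\<lambda>s. v (x, s, z)) y + x / 2 * deriv (\<lambda>s. v (x, y, s)) z"
proof -
  from assms obtain v' where v': "(v has_derivative v') (at (x, y, z))"
    by (auto simp: differentiable_def)
  have lin: "linear v'" using v' by (rule has_derivative_linear)
  have split: "v' (a, b, c) = a * v' (1, 0, 0) + b * v' (0, 1, 0) + c * v' (0, 0, 1)" for a b c
  proof -
    have "(a, b, c) = a *\<^sub>R (1, 0, 0) + b *\<^sub>R (0, 1, 0) + c *\<^sub>R (0, 0, 1 :: real)" by simp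
    then show ?thesis by (simp only: linear_add[OF lin] linear_scale[OF lin]) simp
  qed
  show "dX v (x, y, z) = deriv (\<lambda>s. v (s, y, z)) x - y / 2 * deriv (\<lambda>s. v (x, y, s)) z"
    unfolding field_deriv_eq[OF v'] partial_eq[OF v'] X_field_def
    using split[of 1 0 "- (y / 2)"] by simp
  show "dY v (x, y, z) = deriv (\<lambda>s. v (x, s, z)) y + x / 2 * deriv (\<lambda>s. v (x, y, s)) z"
    unfolding field_deriv_eq[OF v'] partial_eq[OF v'] Y_field_def
    using split[of 0 1 "x / 2"] by simp
qed

lemma X_field_deriv: "(X_field has_derivative (\<lambda>(a, b, c). (0, 0, - (b / 2)))) (at q)"
  and Y_field_deriv: "(Y_field has_derivative (\<lambda>(a, b, c). (0, 0, a / 2))) (at q)"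
  unfolding X_field_def Y_field_def case_prod_unfold
  by (auto intro!: derivative_eq_intros)

lemma continuous_on_X_field: "continuous_on UNIV X_field"
  and continuous_on_Y_field: "continuous_on UNIV Y_field"
  using X_field_deriv Y_field_deriv
  by (meson continuous_at_imp_continuous_on has_derivative_continuous)+

lemma heis_C1_if_euclidean_C1:
  fixes v' :: "heis \<Rightarrow> heis \<Rightarrow> real"
  assumes d: "\<And>q. (v has_derivative v' q) (at q)"
    and cont: "\<And>W. continuous_on UNIV W \<Longrightarrow> continuous_on UNIV (\<lambda>q. v' q (W q))"
  shows "heis_C1 v"
proof -
  have "continuous_on UNIV v"
    using d by (meson continuous_at_imp_continuous_on has_derivative_continuous)
  moreover have "field_deriv W v = (\<lambda>q. v' q (W q))" for W
    using field_deriv_eq[OF d] by auto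
  moreover have "(\<lambda>t. v (q + t *\<^sub>R W q)) differentiable (at 0)" for W q
    using field_deriv_line[OF d] unfolding real_differentiable_def by blast
  ultimately show ?thesis
    unfolding heis_C1_def using cont continuous_on_X_field continuous_on_Y_field by auto
qed

lemma heis_C2_if_euclidean_C2:
  fixes v' :: "heis \<Rightarrow> heis \<Rightarrow>\<^sub>L real" and v'' :: "heis \<Rightarrow> heis \<Rightarrow>\<^sub>L heis \<Rightarrow>\<^sub>L real"
  assumes d1: "\<And>q. (v has_derivative blinfun_apply (v' q)) (at q)"
    and d2: "\<And>q. (v' has_derivative blinfun_apply (v'' q)) (at q)"
    and cont: "continuous_on UNIV v''"
  shows "heis_C2 v"
proof -
  have c1: "continuous_on UNIV v'"
    using d2 by (meson continuous_at_imp_continuous_on has_derivative_continuous)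
  have "heis_C1 v"
    by (rule heis_C1_if_euclidean_C1[OF d1]) (intro continuous_intros c1)
  moreover have "heis_C1 (field_deriv W v)"
    if W: "\<And>q. (W has_derivative W') (at q)" and W': "continuous_on UNIV W'" for W W'
  proof -
    have cW: "continuous_on UNIV W"
      using W by (meson continuous_at_imp_continuous_on has_derivative_continuous)
    have eq: "field_deriv W v = (\<lambda>q. v' q (W q))" using field_deriv_eq[OF d1] by auto
    have "((\<lambda>q. v' q (W q)) has_derivative (\<lambda>h. v' q (W' h) + v'' q h (W q))) (at q)" for q
      by (rule bounded_bilinear.FDERIV[OF bounded_bilinear_blinfun_apply d2 W])
    then show ?thesis
      unfolding eq
    proof (rule heis_C1_if_euclidean_C1)
      fix V :: "heis \<Rightarrow> heis" assume V: "continuous_on UNIV V"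
      have "continuous_on UNIV (\<lambda>q. W' (V q))"
        using continuous_on_compose2[OF W' V] by simp
      then show "continuous_on UNIV (\<lambda>q. v' q (W' (V q)) + v'' q (V q) (W q))"
        by (intro continuous_intros c1 cont cW V)
    qed
  qed
  moreover have "continuous_on UNIV (\<lambda>(a, b, c). (0, 0, - (b / 2)) :: heis)"
    "continuous_on UNIV (\<lambda>(a, b, c). (0, 0, a / 2) :: heis)"
    unfolding case_prod_unfold by (intro continuous_intros; simp)+
  ultimately show ?thesis
    unfolding heis_C2_def using X_field_deriv Y_field_deriv by blast
qed

end

(* The horizontal Taylor formula
     v(q * (a,b,c)) = v(q) + a Xv + b Yv + (a^2 XXv + ab (XYv + YXv) + b^2 YYv) / 2 + c [X,Y]v + o(r^2)
   on gauge balls of radius r needs only horizontal derivatives: every point of such a ball is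
   reached from q by six segments along X or Y of length O(r), and the horizontal derivatives of
   the error are o(r) by the first-order formula for Xv and Yv.  With g = |grad v(q)| > 0 and p the unit
   vector along the gradient, the supremum of the Taylor polynomial over the ball is
   v(q) + r g + (r^2/2) <Hess v p, p> + O(r^3): away from the horizontal point r p, the loss in
   the linear term dominates the possible gain in the vertical and quadratic terms.
   Applied to v and to -v, the first-order terms r g cancel in the sum of inf and sup. *)
theory Submission
  imports Defs
begin

section \<open>Anisotropic boxes and horizontal lines\<close>

text \<open>The vertical side scales quadratically, matching the group dilations, so a box stands in
  for a gauge ball of comparable radius. For negative \<open>R\<close> the box is empty, which lets
  the Taylor statements quantify over all \<open>\<rho>\<close> below
  \<open>\<delta>\<close>.\<close>

definition heis_box :: "real \<Rightarrow> heis set" where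
  "heis_box R = {(a, b, c). \<bar>a\<bar> \<le> R \<and> \<bar>b\<bar> \<le> R \<and> \<bar>c\<bar> \<le> R\<^sup>2}"

lemma heis_box_mono: "0 \<le> R \<Longrightarrow> R \<le> R' \<Longrightarrow> heis_box R \<subseteq> heis_box R'"
  unfolding heis_box_def by clarsimp (smt (verit) power_mono)

lemma X_field_line: "(a, b, c) + t *\<^sub>R X_field (a, b, c) = (a + t, b, c - t * b / 2)"
  and Y_field_line: "(a, b, c) + t *\<^sub>R Y_field (a, b, c) = (a, b + t, c + t * a / 2)"
  by (simp_all add: X_field_def Y_field_def)

lemma X_field_invariant: "X_field (p + t *\<^sub>R X_field p) = X_field p"
  and Y_field_invariant: "Y_field (p + t *\<^sub>R Y_field p) = Y_field p"
  by (simp_all add: X_field_def Y_field_def split: prod.splits)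

text \<open>A horizontal move of length \<open>S\<close> changes the vertical coordinate by at most
  \<open>S * R / 2\<close>, which the cross term of \<open>(R + S)\<^sup>2\<close> absorbs. Hence
  box radii simply add along horizontal paths.\<close>

lemma heis_box_line_bound:
  fixes b c t :: real
  assumes "\<bar>b\<bar> \<le> R" "\<bar>c\<bar> \<le> R\<^sup>2" "\<bar>t\<bar> \<le> S"
  shows "\<bar>c - t * b / 2\<bar> \<le> (R + S)\<^sup>2" "\<bar>c + t * b / 2\<bar> \<le> (R + S)\<^sup>2"
proof -
  have RS: "0 \<le> R" "0 \<le> S" using assms by linarith+
  have "\<bar>t * b\<bar> \<le> S * R" unfolding abs_mult using assms RS by (intro mult_mono) auto
  moreover have "(R + S)\<^sup>2 = R\<^sup>2 + 2 * (S * R) + S\<^sup>2" by (simp add: power2_eq_square algebra_simps)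
  moreover have "0 \<le> S * R" "0 \<le> S\<^sup>2" using RS by auto
  ultimately show "\<bar>c - t * b / 2\<bar> \<le> (R + S)\<^sup>2" "\<bar>c + t * b / 2\<bar> \<le> (R + S)\<^sup>2"
    using assms(2) by linarith+
qed

lemma heis_box_X_line:
  assumes "p \<in> heis_box R" "\<bar>t\<bar> \<le> S"
  shows "p + t *\<^sub>R X_field p \<in> heis_box (R + S)"
  using assms heis_box_line_bound(1)[of _ R _ t S]
  by (cases p) (auto simp: heis_box_def X_field_line simp del: plus_prod_def scaleR_prod_def)

lemma heis_box_Y_line:
  assumes "p \<in> heis_box R" "\<bar>t\<bar> \<le> S"
  shows "p + t *\<^sub>R Y_field p \<in> heis_box (R + S)"
  using assms heis_box_line_bound(2)[of _ R _ t S]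
  by (cases p) (auto simp: heis_box_def Y_field_line simp del: plus_prod_def scaleR_prod_def)

section \<open>Increments along horizontal paths\<close>

text \<open>Since \<open>W\<close> is constant along its own lines, restarting at a later point
  continues the same line; derivatives at time 0 from all base points thus give derivatives at all
  times.\<close>

lemma derivative_along_line:
  fixes u :: "heis \<Rightarrow> real"
  assumes W: "\<And>p t. W (p + t *\<^sub>R W p) = W p"
    and deriv: "\<And>p. ((\<lambda>t. u (p + t *\<^sub>R W p)) has_real_derivative u' p) (at 0)"
  shows "((\<lambda>t. u (p + t *\<^sub>R W p)) has_real_derivative u' (p + t *\<^sub>R W p)) (at t)"
proof -
  have "((\<lambda>s. u (p + (t + s) *\<^sub>R W p)) has_real_derivative u' (p + t *\<^sub>R W p)) (at 0)"
    using deriv[of "p + t *\<^sub>R W p"] by (simp add: W scaleR_add_left add.assoc)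
  then show ?thesis
    using DERIV_at_within_shift[of "\<lambda>t. u (p + t *\<^sub>R W p)" _ t 0 UNIV] by simp
qed

lemma increment_along_line:
  fixes u :: "heis \<Rightarrow> real"
  assumes W: "\<And>p t. W (p + t *\<^sub>R W p) = W p"
    and deriv: "\<And>p. ((\<lambda>t. u (p + t *\<^sub>R W p)) has_real_derivative u' p) (at 0)"
    and bound: "\<And>t. \<bar>t\<bar> \<le> \<bar>s\<bar> \<Longrightarrow> \<bar>u' (p + t *\<^sub>R W p)\<bar> \<le> M"
  shows "\<bar>u (p + s *\<^sub>R W p) - u p\<bar> \<le> \<bar>s\<bar> * M"
proof -
  have "norm (u (p + s *\<^sub>R W p) - u (p + 0 *\<^sub>R W p)) \<le> M * norm (s - 0)"
    by (rule field_differentiable_bound[where S = "{- \<bar>s\<bar>..\<bar>s\<bar>}"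
          and f' = "\<lambda>t. u' (p + t *\<^sub>R W p)"])
       (auto intro!: has_field_derivative_at_within[OF derivative_along_line[OF W deriv]] bound)
  then show ?thesis by (simp add: mult.commute)
qed

text \<open>A point \<open>(a, b, c)\<close> is reached from the origin by following \<open>X\<close> for time \<open>a\<close> and \<open>Y\<close> for
  time \<open>b\<close>, which leads to \<open>(a, b, ab/2)\<close>, and then a commutator loop of sides \<open>s\<close> and \<open>t\<close> with
  \<open>s t = c - ab/2\<close>.\<close>

lemma increment_on_heis_box:
  fixes u :: "heis \<Rightarrow> real"
  assumes X: "\<And>p. ((\<lambda>t. u (p + t *\<^sub>R X_field p)) has_real_derivative Xu p) (at 0)"
    and Y: "\<And>p. ((\<lambda>t. u (p + t *\<^sub>R Y_field p)) has_real_derivative Yu p) (at 0)"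
    and bound: "\<And>p. p \<in> heis_box (10 * \<rho>) \<Longrightarrow> \<bar>Xu p\<bar> \<le> M \<and> \<bar>Yu p\<bar> \<le> M"
    and h: "h \<in> heis_box \<rho>"
  shows "\<bar>u h - u (0, 0, 0)\<bar> \<le> 10 * \<rho> * M"
proof -
  obtain a b c where abc: "h = (a, b, c)" by (cases h)
  have a: "\<bar>a\<bar> \<le> \<rho>" and b: "\<bar>b\<bar> \<le> \<rho>" and c: "\<bar>c\<bar> \<le> \<rho>\<^sup>2"
    using h by (auto simp: abc heis_box_def)
  have \<rho>: "0 \<le> \<rho>" using a by linarith
  have "(0, 0, 0) \<in> heis_box (10 * \<rho>)" using \<rho> by (simp add: heis_box_def)
  from bound[OF this] have M: "0 \<le> M" by linarith
  have stepX: "p + t *\<^sub>R X_field p \<in> heis_box (R + S) \<and> \<bar>u (p + t *\<^sub>R X_field p) - u p\<bar> \<le> S * M"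
    if "p \<in> heis_box R" "\<bar>t\<bar> \<le> S" "R + S \<le> 10 * \<rho>" "0 \<le> R" for p t R S
  proof -
    have "\<bar>u (p + t *\<^sub>R X_field p) - u p\<bar> \<le> \<bar>t\<bar> * M"
    proof (rule increment_along_line[OF X_field_invariant X])
      fix t' assume "\<bar>t'\<bar> \<le> \<bar>t\<bar>"
      then have "p + t' *\<^sub>R X_field p \<in> heis_box (R + S)" using that by (intro heis_box_X_line) auto
      then show "\<bar>Xu (p + t' *\<^sub>R X_field p)\<bar> \<le> M"
        using bound heis_box_mono[of "R + S" "10 * \<rho>"] that by fastforce
    qed
    also have "\<dots> \<le> S * M" using that M by (intro mult_right_mono) auto
    finally show ?thesis using heis_box_X_line that by blast
  qed
  have stepY: "p + t *\<^sub>R Y_field p \<in> heis_box (R + S) \<and> \<bar>u (p + t *\<^sub>R Y_field p) - u p\<bar> \<le> S * M"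
    if "p \<in> heis_box R" "\<bar>t\<bar> \<le> S" "R + S \<le> 10 * \<rho>" "0 \<le> R" for p t R S
  proof -
    have "\<bar>u (p + t *\<^sub>R Y_field p) - u p\<bar> \<le> \<bar>t\<bar> * M"
    proof (rule increment_along_line[OF Y_field_invariant Y])
      fix t' assume "\<bar>t'\<bar> \<le> \<bar>t\<bar>"
      then have "p + t' *\<^sub>R Y_field p \<in> heis_box (R + S)" using that by (intro heis_box_Y_line) auto
      then show "\<bar>Yu (p + t' *\<^sub>R Y_field p)\<bar> \<le> M"
        using bound heis_box_mono[of "R + S" "10 * \<rho>"] that by fastforce
    qed
    also have "\<dots> \<le> S * M" using that M by (intro mult_right_mono) auto
    finally show ?thesis using heis_box_Y_line that by blast
  qed
  \<comment> \<open>Both sides of the loop get length \<open>sqrt \<bar>e\<bar>\<close>, which is at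
    most \<open>2 * \<rho>\<close>; the sign of \<open>e\<close> is carried by \<open>t\<close>
    alone.\<close>
  define e where "e = c - a * b / 2"
  define s where "s = sqrt \<bar>e\<bar>"
  define t where "t = sgn e * s"
  have st: "s * t = e"
    by (simp add: s_def t_def abs_mult_sgn flip: mult.assoc)
       (metis abs_mult_sgn abs_ge_zero mult.assoc mult.commute real_sqrt_mult_self abs_of_nonneg)
  have "\<bar>a * b\<bar> \<le> \<rho> * \<rho>" unfolding abs_mult using a b by (intro mult_mono) auto
  then have "\<bar>e\<bar> \<le> 2 * \<rho>\<^sup>2" using c unfolding e_def power2_eq_square by linarith
  also have "\<dots> \<le> (2 * \<rho>)\<^sup>2" by (simp add: power2_eq_square)
  finally have s: "\<bar>s\<bar> \<le> 2 * \<rho>"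
    unfolding s_def using \<rho> by (simp add: real_le_lsqrt)
  have t: "\<bar>t\<bar> \<le> 2 * \<rho>"
    using s \<rho> by (auto simp: t_def abs_mult abs_sgn_eq)
  \<comment> \<open>The six segments have lengths at most 1, 1, 2, 2, 2, 2 times
    \<open>\<rho>\<close>. Their sum is the source of the factor 10, both in the bound and in the
    radius of the box where the derivatives are controlled.\<close>
  define p0 p1 p2 p3 p4 p5 p6 :: heis where p:
    "p0 = (0, 0, 0)" "p1 = p0 + a *\<^sub>R X_field p0" "p2 = p1 + b *\<^sub>R Y_field p1"
    "p3 = p2 + s *\<^sub>R X_field p2" "p4 = p3 + t *\<^sub>R Y_field p3"
    "p5 = p4 + (- s) *\<^sub>R X_field p4" "p6 = p5 + (- t) *\<^sub>R Y_field p5"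
  have "p6 = (a, b, a * b / 2 + s * t)"
    unfolding p X_field_line Y_field_line by (simp add: field_simps)
  then have p6: "p6 = h" using st by (simp add: abc e_def)
  have 0: "p0 \<in> heis_box 0" by (simp add: p heis_box_def)
  have 1: "p1 \<in> heis_box \<rho> \<and> \<bar>u p1 - u p0\<bar> \<le> \<rho> * M"
    using stepX[OF 0 a] \<rho> by (simp add: p(2))
  have 2: "p2 \<in> heis_box (2 * \<rho>) \<and> \<bar>u p2 - u p1\<bar> \<le> \<rho> * M"
    using stepY[OF conjunct1[OF 1] b] \<rho> by (simp add: p(3))
  have 3: "p3 \<in> heis_box (4 * \<rho>) \<and> \<bar>u p3 - u p2\<bar> \<le> 2 * \<rho> * M"
    using stepX[OF conjunct1[OF 2] s] \<rho> by (simp add: p(4))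
  have 4: "p4 \<in> heis_box (6 * \<rho>) \<and> \<bar>u p4 - u p3\<bar> \<le> 2 * \<rho> * M"
    using stepY[OF conjunct1[OF 3] t] \<rho> by (simp add: p(5))
  have 5: "p5 \<in> heis_box (8 * \<rho>) \<and> \<bar>u p5 - u p4\<bar> \<le> 2 * \<rho> * M"
    using stepX[OF conjunct1[OF 4], of "- s" "2 * \<rho>"] s \<rho> by (simp add: p(6))
  have 6: "\<bar>u p6 - u p5\<bar> \<le> 2 * \<rho> * M"
    using stepY[OF conjunct1[OF 5], of "- t" "2 * \<rho>"] t \<rho> by (simp add: p(7))
  have "\<bar>u p6 - u p0\<bar> \<le> 10 * (\<rho> * M)" using 1 2 3 4 5 6 by linarith
  then show ?thesis by (simp add: p6 p(1))
qed

section \<open>Left invariance and horizontal Taylor formulas\<close>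

lemma heis_mult_assoc: "heis_mult (heis_mult p q) r = heis_mult p (heis_mult q r)"
  by (auto simp: heis_mult_def field_simps split: prod.splits)

lemma heis_mult_zero: "heis_mult q (0, 0, 0) = q" "heis_mult (0, 0, 0) q = q"
  by (auto simp: heis_mult_def split: prod.splits)

text \<open>Left invariance of the fields: their lines are right multiplications, which commute with
  left translation by associativity.\<close>

lemma heis_mult_X_line: "heis_mult q (h + t *\<^sub>R X_field h) = heis_mult q h + t *\<^sub>R X_field (heis_mult q h)"
  and heis_mult_Y_line: "heis_mult q (h + t *\<^sub>R Y_field h) = heis_mult q h + t *\<^sub>R Y_field (heis_mult q h)"
  by (simp_all only: X_line Y_line heis_mult_assoc)

lemma heis_C1_translate_deriv:
  assumes "heis_C1 f"
  shows "((\<lambda>t. f (heis_mult q (h + t *\<^sub>R X_field h))) has_real_derivative dX f (heis_mult q h)) (at 0)"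
    and "((\<lambda>t. f (heis_mult q (h + t *\<^sub>R Y_field h))) has_real_derivative dY f (heis_mult q h)) (at 0)"
  using assms unfolding heis_mult_X_line heis_mult_Y_line field_deriv_def heis_C1_def
  by (simp_all only: DERIV_deriv_iff_real_differentiable)

lemma continuous_heis_mult: "continuous_on UNIV (heis_mult q)"
  unfolding heis_mult_def case_prod_unfold by (intro continuous_intros) auto

lemma continuous_near_heis_box:
  fixes f :: "heis \<Rightarrow> real"
  assumes "continuous_on UNIV f" "\<epsilon> > 0"
  shows "\<exists>\<delta>>0. \<forall>\<rho><\<delta>. \<forall>h\<in>heis_box \<rho>. \<bar>f (heis_mult q h) - f q\<bar> \<le> \<epsilon>"
proof -
  have "continuous_on UNIV (\<lambda>h. f (heis_mult q h))"
    by (rule continuous_on_compose2[OF assms(1) continuous_heis_mult]) auto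
  then have "isCont (\<lambda>h. f (heis_mult q h)) (0, 0, 0)"
    by (simp add: continuous_on_eq_continuous_at)
  then obtain d where d: "d > 0"
    "\<And>h. dist h (0, 0, 0) < d \<Longrightarrow> dist (f (heis_mult q h)) (f (heis_mult q (0, 0, 0))) < \<epsilon>"
    unfolding continuous_at_eps_delta using assms(2) by blast
  show ?thesis
  \<comment> \<open>With \<open>\<rho> < 1\<close> the vertical side is at most
    \<open>\<rho>\<close> too, so the Euclidean norm is at most
    \<open>3 * \<rho> < d\<close>.\<close>
  proof (intro exI[of _ "min 1 (d / 4)"] conjI allI impI ballI)
    show "0 < min 1 (d / 4)" using d by simp
    fix \<rho> h assume \<rho>: "\<rho> < min 1 (d / 4)" and h: "h \<in> heis_box \<rho>"
    obtain a b c where abc: "h = (a, b, c)" by (cases h)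
    have bounds: "\<bar>a\<bar> \<le> \<rho>" "\<bar>b\<bar> \<le> \<rho>" "\<bar>c\<bar> \<le> \<rho>\<^sup>2" using h by (auto simp: abc heis_box_def)
    then have "0 \<le> \<rho>" by linarith
    then have "\<rho>\<^sup>2 \<le> \<rho>" using \<rho> by (simp add: power2_eq_square mult_left_le)
    have "norm h \<le> norm a + norm (b, c)" unfolding abc by (rule norm_Pair_le)
    also have "norm (b, c) \<le> norm b + norm c" by (rule norm_Pair_le)
    finally have "norm h < d" using bounds \<open>\<rho>\<^sup>2 \<le> \<rho>\<close> \<rho> \<open>0 \<le> \<rho>\<close> d(1) by auto
    then have "dist h (0, 0, 0) < d" by (simp add: dist_norm flip: zero_prod_def)
    from d(2)[OF this] show "\<bar>f (heis_mult q h) - f q\<bar> \<le> \<epsilon>"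
      by (simp add: heis_mult_zero dist_real_def)
  qed
qed

text \<open>The horizontal derivatives of the remainder are the oscillations of \<open>dX f\<close>
  and \<open>dY f\<close> around \<open>q\<close>, small by continuity;
  \<open>increment_on_heis_box\<close> integrates them.\<close>

lemma heis_C1_taylor:
  assumes f: "heis_C1 f" and "\<epsilon> > 0"
  shows "\<exists>\<delta>>0. \<forall>\<rho><\<delta>. \<forall>(a, b, c)\<in>heis_box \<rho>.
    \<bar>f (heis_mult q (a, b, c)) - (f q + a * dX f q + b * dY f q)\<bar> \<le> \<epsilon> * \<rho>"
proof -
  have "continuous_on UNIV (dX f)" "continuous_on UNIV (dY f)"
    using f by (auto simp: heis_C1_def)
  note near = this[THEN continuous_near_heis_box, of "\<epsilon> / 10" q]
  have e: "\<epsilon> / 10 > 0" using \<open>\<epsilon> > 0\<close> by simp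
  obtain d1 where d1: "d1 > 0"
    "\<And>\<rho> h. \<rho> < d1 \<Longrightarrow> h \<in> heis_box \<rho> \<Longrightarrow> \<bar>dX f (heis_mult q h) - dX f q\<bar> \<le> \<epsilon> / 10"
    using near(1)[OF e] by blast
  obtain d2 where d2: "d2 > 0"
    "\<And>\<rho> h. \<rho> < d2 \<Longrightarrow> h \<in> heis_box \<rho> \<Longrightarrow> \<bar>dY f (heis_mult q h) - dY f q\<bar> \<le> \<epsilon> / 10"
    using near(2)[OF e] by blast
  define u where "u = (\<lambda>h::heis. f (heis_mult q h) - (fst h * dX f q + fst (snd h) * dY f q))"
  have X: "((\<lambda>t. u (h + t *\<^sub>R X_field h)) has_real_derivative dX f (heis_mult q h) - dX f q) (at 0)" for h
    unfolding u_def
    by (rule DERIV_diff[OF heis_C1_translate_deriv(1)[OF f]],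
        cases h, auto simp: X_field_line intro!: derivative_eq_intros
          simp del: plus_prod_def scaleR_prod_def)
  have Y: "((\<lambda>t. u (h + t *\<^sub>R Y_field h)) has_real_derivative dY f (heis_mult q h) - dY f q) (at 0)" for h
    unfolding u_def
    by (rule DERIV_diff[OF heis_C1_translate_deriv(2)[OF f]],
        cases h, auto simp: Y_field_line intro!: derivative_eq_intros
          simp del: plus_prod_def scaleR_prod_def)
  show ?thesis
  \<comment> \<open>The path leaves the box of radius \<open>\<rho>\<close> but stays in the one of
    radius \<open>10 * \<rho>\<close>, which must remain below \<open>d1\<close> and
    \<open>d2\<close>.\<close>
  proof (intro exI[of _ "min d1 d2 / 10"] conjI allI impI ballI, goal_cases)
    case 1 show ?case using d1 d2 by simp
  next
    case (2 \<rho> h)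
    then have "\<bar>u h - u (0, 0, 0)\<bar> \<le> 10 * \<rho> * (\<epsilon> / 10)"
      by (intro increment_on_heis_box[OF X Y]) (auto simp only: split_paired_all intro!: conjI d1(2) d2(2))
    then show ?case by (cases h) (simp add: u_def heis_mult_zero algebra_simps)
  qed
qed

text \<open>\<open>A\<close>, \<open>B\<close>, \<open>D\<close> stand for \<open>XXv\<close>, \<open>XYv + YXv\<close>, \<open>YYv\<close>, and \<open>T\<close> for the derivative \<open>[X, Y]v\<close> in the
  direction of the center.\<close>

definition heis_taylor2 :: "(heis \<Rightarrow> real) \<Rightarrow> heis \<Rightarrow> real \<Rightarrow> real \<Rightarrow> real \<Rightarrow> real \<Rightarrow> real \<Rightarrow> real \<Rightarrow> bool" where
  "heis_taylor2 v q gx gy A B D T \<longleftrightarrow> (\<forall>\<epsilon>>0. \<exists>\<delta>>0. \<forall>\<rho><\<delta>. \<forall>(a, b, c)\<in>heis_box \<rho>.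
    \<bar>v (heis_mult q (a, b, c)) - (v q + a * gx + b * gy + (a\<^sup>2 * A + a * b * B + b\<^sup>2 * D) / 2 + c * T)\<bar>
      \<le> \<epsilon> * \<rho>\<^sup>2)"

text \<open>The horizontal derivatives of the second-order remainder are exactly the first-order
  remainders of \<open>dX v\<close> and \<open>dY v\<close>, hence \<open>o(\<rho>)\<close>; one
  more integration along paths gives \<open>o(\<rho>\<^sup>2)\<close>.\<close>

lemma heis_C2_taylor:
  assumes v: "heis_C2 v"
  shows "heis_taylor2 v q (dX v q) (dY v q) (dX (dX v) q) (dX (dY v) q + dY (dX v) q) (dY (dY v) q)
     (dX (dY v) q - dY (dX v) q)"
  unfolding heis_taylor2_def
proof (intro allI impI)
  fix \<epsilon> :: real assume "\<epsilon> > 0"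
  \<comment> \<open>One factor 10 comes from the path length, the other from the first-order
    estimate being used at radius \<open>10 * \<rho>\<close>.\<close>
  then have e: "\<epsilon> / 100 > 0" by simp
  have v1: "heis_C1 v" and vX: "heis_C1 (dX v)" and vY: "heis_C1 (dY v)"
    using v by (auto simp: heis_C2_def)
  \<comment> \<open>Here \<open>B\<close> is a single mixed derivative; the coefficient
    \<open>B\<close> of \<open>heis_taylor2\<close> is \<open>C + B\<close>.\<close>
  define A B C D where ABCD: "A = dX (dX v) q" "B = dY (dX v) q" "C = dX (dY v) q" "D = dY (dY v) q"
  obtain d1 where d1: "d1 > 0" "\<And>\<rho> a b c. \<rho> < d1 \<Longrightarrow> (a, b, c) \<in> heis_box \<rho> \<Longrightarrow>
    \<bar>dX v (heis_mult q (a, b, c)) - (dX v q + a * A + b * B)\<bar> \<le> \<epsilon> / 100 * \<rho>"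
    using heis_C1_taylor[OF vX e, of q] unfolding ABCD by blast
  obtain d2 where d2: "d2 > 0" "\<And>\<rho> a b c. \<rho> < d2 \<Longrightarrow> (a, b, c) \<in> heis_box \<rho> \<Longrightarrow>
    \<bar>dY v (heis_mult q (a, b, c)) - (dY v q + a * C + b * D)\<bar> \<le> \<epsilon> / 100 * \<rho>"
    using heis_C1_taylor[OF vY e, of q] unfolding ABCD by blast
  \<comment> \<open>The vertical coefficient \<open>C - B\<close> splits the symmetric mixed term
    correctly: differentiating \<open>P\<close> along X leaves \<open>b * B\<close>, and along Y
    leaves \<open>a * C\<close>.\<close>
  define P where "P = (\<lambda>(a, b, c). a * dX v q + b * dY v q
    + (a\<^sup>2 * A + a * b * (C + B) + b\<^sup>2 * D) / 2 + c * (C - B))"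
  define u where "u = (\<lambda>h. v (heis_mult q h) - P h)"
  define Xu Yu where XYu:
    "Xu = (\<lambda>(a, b, c). dX v (heis_mult q (a, b, c)) - (dX v q + a * A + b * B))"
    "Yu = (\<lambda>(a, b, c). dY v (heis_mult q (a, b, c)) - (dY v q + a * C + b * D))"
  have "((\<lambda>t. P (h + t *\<^sub>R X_field h)) has_real_derivative dX v q + fst h * A + fst (snd h) * B) (at 0)" for h
    by (cases h; simp only: X_field_line P_def prod.case)
       (auto intro!: derivative_eq_intros simp: field_simps)
  then have X: "((\<lambda>t. u (h + t *\<^sub>R X_field h)) has_real_derivative Xu h) (at 0)" for h
    unfolding u_def XYu case_prod_unfold prod.collapse
    by (intro DERIV_diff heis_C1_translate_deriv[OF v1])
  have "((\<lambda>t. P (h + t *\<^sub>R Y_field h)) has_real_derivative dY v q + fst h * C + fst (snd h) * D) (at 0)" for h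
    by (cases h; simp only: Y_field_line P_def prod.case)
       (auto intro!: derivative_eq_intros simp: field_simps)
  then have Y: "((\<lambda>t. u (h + t *\<^sub>R Y_field h)) has_real_derivative Yu h) (at 0)" for h
    unfolding u_def XYu case_prod_unfold prod.collapse
    by (intro DERIV_diff heis_C1_translate_deriv[OF v1])
  have "\<exists>\<delta>>0. \<forall>\<rho><\<delta>. \<forall>h\<in>heis_box \<rho>. \<bar>u h - u (0, 0, 0)\<bar> \<le> \<epsilon> * \<rho>\<^sup>2"
  proof (intro exI[of _ "min d1 d2 / 10"] conjI allI impI ballI)
    show "0 < min d1 d2 / 10" using d1 d2 by simp
    fix \<rho> h assume \<rho>: "\<rho> < min d1 d2 / 10" and h: "h \<in> heis_box \<rho>"
    have "\<bar>u h - u (0, 0, 0)\<bar> \<le> 10 * \<rho> * (\<epsilon> / 100 * (10 * \<rho>))"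
      using \<rho> by (intro increment_on_heis_box[OF X Y _ h])
        (auto simp only: XYu prod.case split_paired_all intro!: conjI d1(2) d2(2))
    then show "\<bar>u h - u (0, 0, 0)\<bar> \<le> \<epsilon> * \<rho>\<^sup>2" by (simp add: power2_eq_square mult_ac)
  qed
  then show "\<exists>\<delta>>0. \<forall>\<rho><\<delta>. \<forall>(a, b, c)\<in>heis_box \<rho>.
    \<bar>v (heis_mult q (a, b, c)) - (v q + a * dX v q + b * dY v q
      + (a\<^sup>2 * dX (dX v) q + a * b * (dX (dY v) q + dY (dX v) q) + b\<^sup>2 * dY (dY v) q) / 2
      + c * (dX (dY v) q - dY (dX v) q))\<bar> \<le> \<epsilon> * \<rho>\<^sup>2"
    by (simp add: u_def P_def heis_mult_zero case_prod_unfold ABCD algebra_simps)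
qed

text \<open>Allows the infimum of \<open>v\<close> to be treated as a supremum of
  \<open>-v\<close>.\<close>

lemma heis_taylor2_uminus:
  assumes "heis_taylor2 v q gx gy A B D T"
  shows "heis_taylor2 (\<lambda>p. - v p) q (- gx) (- gy) (- A) (- B) (- D) (- T)"
proof -
  have "\<bar>- x - (- y + a * - gx + b * - gy + (a\<^sup>2 * - A + a * b * - B + b\<^sup>2 * - D) / 2 + c * - T)\<bar> =
    \<bar>x - (y + a * gx + b * gy + (a\<^sup>2 * A + a * b * B + b\<^sup>2 * D) / 2 + c * T)\<bar>" for x y a b c :: real
    by (simp add: abs_minus_commute[of x] field_simps)
  then show ?thesis using assms unfolding heis_taylor2_def by simp
qed

section \<open>Gauge balls in translated coordinates\<close>

text \<open>By left invariance the distance from \<open>q\<close> is the gauge of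
  \<open>(a, b, c)\<close>. The condition \<open>0 < r\<close> stays explicit because the fourth
  power forgets the sign of \<open>r\<close>.\<close>

lemma heis_ball_iff:
  "heis_mult q (a, b, c) \<in> heis_ball r q \<longleftrightarrow> 0 < r \<and> (a\<^sup>2 + b\<^sup>2)\<^sup>2 + 16 * c\<^sup>2 < r ^ 4"
proof -
  have "heis_dist q (heis_mult q (a, b, c)) = root 4 ((a\<^sup>2 + b\<^sup>2)\<^sup>2 + 16 * c\<^sup>2)" (is "_ = root 4 ?k")
    by (simp add: heis_dist_def koranyi_gauge_def heis_inv_left heis_mult_zero flip: heis_mult_assoc)
  moreover have "root 4 ?k < r \<longleftrightarrow> 0 < r \<and> ?k < r ^ 4"
  proof -
    have k: "0 \<le> root 4 ?k" "root 4 ?k ^ 4 = ?k" by simp_all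
    show ?thesis
    proof
      assume less: "root 4 ?k < r"
      then have "0 < r" using k(1) by linarith
      moreover have "root 4 ?k ^ 4 < r ^ 4" by (rule power_strict_mono[OF less k(1)]) simp
      ultimately show "0 < r \<and> ?k < r ^ 4" unfolding k(2) by blast
    next
      assume r: "0 < r \<and> ?k < r ^ 4"
      then have "root 4 ?k ^ 4 < r ^ 4" unfolding k(2) by blast
      then show "root 4 ?k < r" by (rule power_less_imp_less_base) (use r in simp)
    qed
  qed
  ultimately show ?thesis by (simp add: heis_ball_def)
qed

lemma heis_ballE:
  assumes "p \<in> heis_ball r q"
  obtains a b c where "p = heis_mult q (a, b, c)" "(a\<^sup>2 + b\<^sup>2)\<^sup>2 + 16 * c\<^sup>2 < r ^ 4"
proof -
  obtain a b c where "heis_mult (heis_inv q) p = (a, b, c)" by (cases "heis_mult (heis_inv q) p")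
  then have "p = heis_mult q (a, b, c)"
    by (metis heis_mult_assoc heis_inv_right heis_mult_zero(2))
  with assms show ?thesis using heis_ball_iff that by blast
qed

lemma koranyi_box:
  assumes "(a\<^sup>2 + b\<^sup>2)\<^sup>2 + 16 * c\<^sup>2 < r ^ 4" "0 < r"
  shows "(a, b, c) \<in> heis_box r" "a\<^sup>2 + b\<^sup>2 \<le> r\<^sup>2"
proof -
  have r4: "r ^ 4 = (r\<^sup>2)\<^sup>2" by simp
  have "(a\<^sup>2 + b\<^sup>2)\<^sup>2 \<le> (r\<^sup>2)\<^sup>2" "c\<^sup>2 \<le> (r\<^sup>2)\<^sup>2"
    using assms zero_le_power2[of c] zero_le_power2[of "a\<^sup>2 + b\<^sup>2"] unfolding r4 by linarith+
  then show 1: "a\<^sup>2 + b\<^sup>2 \<le> r\<^sup>2" and "(a, b, c) \<in> heis_box r"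
    using assms(2) power2_le_imp_le[of "a\<^sup>2 + b\<^sup>2" "r\<^sup>2"] abs_le_square_iff[of c "r\<^sup>2"]
      abs_le_square_iff[of a r] abs_le_square_iff[of b r] zero_le_power2[of a] zero_le_power2[of b]
    by (auto simp: heis_box_def)
qed

section \<open>Upper bound for the Taylor polynomial on a gauge ball\<close>

lemma young_quadratic:
  fixes x y k :: real
  assumes "k > 0"
  shows "x * y \<le> k * x\<^sup>2 + y\<^sup>2 / (4 * k)"
proof -
  have "0 \<le> (2 * k * x - y)\<^sup>2 / (4 * k)" using assms by simp
  also have "\<dots> = k * x\<^sup>2 + y\<^sup>2 / (4 * k) - x * y"
    using assms by (simp add: power2_eq_square field_simps)
  finally show ?thesis by simp
qed

text \<open>Let \<open>\<sigma>\<close> be the component of \<open>(a, b)\<close> along the gradient. Both the vertical term \<open>c T\<close> and the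
  deviation of the quadratic form from its value at \<open>r (gx, gy) / g\<close> are at most of order
  \<open>r * sqrt (r (r - \<sigma>))\<close>, so Young's inequality absorbs each into half of the loss \<open>g (r - \<sigma>)\<close> of the
  linear term, up to \<open>O(r^3)\<close>.\<close>

lemma quadratic_polynomial_gauge_ball_upper_bound:
  fixes a b c gx gy A B D T r :: real
  defines "g \<equiv> sqrt (gx\<^sup>2 + gy\<^sup>2)"
  assumes g: "g > 0" and r: "r > 0" and ball: "(a\<^sup>2 + b\<^sup>2)\<^sup>2 + 16 * c\<^sup>2 < r ^ 4"
  shows "a * gx + b * gy + (a\<^sup>2 * A + a * b * B + b\<^sup>2 * D) / 2 + c * T
    \<le> r * g + r\<^sup>2 / 2 * ((gx\<^sup>2 * A + gx * gy * B + gy\<^sup>2 * D) / g\<^sup>2)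
      + (2 * (\<bar>A\<bar> + \<bar>B\<bar> + \<bar>D\<bar>)\<^sup>2 / g + T\<^sup>2 / (8 * g)) * r ^ 3"
proof -
  define px py where p: "px = gx / g" "py = gy / g"
  have g2: "g\<^sup>2 = gx\<^sup>2 + gy\<^sup>2" unfolding g_def by simp
  have gxy: "gx = g * px" "gy = g * py" using g by (simp_all add: p)
  have p1: "px\<^sup>2 + py\<^sup>2 = 1"
    using g2 g by (simp add: gxy power_mult_distrib flip: distrib_left)
  define k where "k = \<bar>A\<bar> + \<bar>B\<bar> + \<bar>D\<bar>"
  define \<sigma> where "\<sigma> = a * px + b * py"
  define w where "w = a\<^sup>2 + b\<^sup>2"
  have w: "0 \<le> w" "w \<le> r\<^sup>2" using koranyi_box(2)[OF ball r] by (auto simp: w_def)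
  have "\<sigma>\<^sup>2 + (a * py - b * px)\<^sup>2 = w * (px\<^sup>2 + py\<^sup>2)"
    by (simp add: \<sigma>_def w_def power2_eq_square algebra_simps)
  then have "\<sigma>\<^sup>2 \<le> w" using zero_le_power2[of "a * py - b * px"] unfolding p1 by linarith
  then have \<sigma>w: "\<sigma> \<le> sqrt w" by (rule real_le_rsqrt)
  have wr: "sqrt w \<le> r" using w r by (simp add: real_le_lsqrt)
  have abr: "\<bar>a\<bar> \<le> r" "\<bar>b\<bar> \<le> r" using koranyi_box(1)[OF ball r] by (auto simp: heis_box_def)
  have pr: "\<bar>px\<bar> \<le> 1" "\<bar>py\<bar> \<le> 1"
    using p1 zero_le_power2[of px] zero_le_power2[of py]
    unfolding abs_square_le_1[symmetric] by linarith+
  define x y where xy: "x = a - r * px" "y = b - r * py"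
  \<comment> \<open>The squared distance from \<open>(a, b)\<close> to the expected maximizer
    \<open>r * (px, py)\<close> is controlled by the linear deficit
    \<open>r - \<sigma>\<close>.\<close>
  have "x\<^sup>2 + y\<^sup>2 = w - 2 * r * \<sigma> + r\<^sup>2 * (px\<^sup>2 + py\<^sup>2)"
    by (simp add: xy w_def \<sigma>_def power2_eq_square algebra_simps)
  then have xy2: "x\<^sup>2 + y\<^sup>2 \<le> 2 * r * (r - \<sigma>)"
    using w(2) unfolding p1 by (simp add: power2_eq_square algebra_simps)
  have quad: "(a\<^sup>2 * A + a * b * B + b\<^sup>2 * D) / 2
      \<le> r\<^sup>2 / 2 * (px\<^sup>2 * A + px * py * B + py\<^sup>2 * D) + g / 2 * (r - \<sigma>) + 2 * k\<^sup>2 * r ^ 3 / g"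
  proof -
    have rp: "\<bar>r * px\<bar> \<le> r" "\<bar>r * py\<bar> \<le> r"
      using pr r by (auto simp: abs_mult mult_left_le)
    \<comment> \<open>The difference of the quadratic form at two points factors through the
      displacement \<open>(x, y)\<close>, with coefficients of order \<open>r\<close>.\<close>
    have "(a\<^sup>2 * A + a * b * B + b\<^sup>2 * D) - r\<^sup>2 * (px\<^sup>2 * A + px * py * B + py\<^sup>2 * D)
      = x * (A * (a + r * px) + B * (r * py)) + y * (B * a + D * (b + r * py))"
      by (simp add: xy power2_eq_square algebra_simps)
    also have "\<dots> \<le> \<bar>x\<bar> * (2 * r * k) + \<bar>y\<bar> * (2 * r * k)"
    proof (intro add_mono)
      have bnd: "\<bar>E * z\<bar> \<le> \<bar>E\<bar> * s" if "\<bar>z\<bar> \<le> s" for E z s :: real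
        unfolding abs_mult by (rule mult_left_mono[OF that]) simp
      have ar: "\<bar>a + r * px\<bar> \<le> 2 * r" "\<bar>b + r * py\<bar> \<le> 2 * r" using abr rp by linarith+
      have kr: "2 * r * k = \<bar>A\<bar> * (2 * r) + \<bar>B\<bar> * r + \<bar>B\<bar> * r + \<bar>D\<bar> * (2 * r)"
        by (simp add: k_def algebra_simps)
      have nn: "0 \<le> \<bar>A\<bar> * (2 * r)" "0 \<le> \<bar>B\<bar> * r" "0 \<le> \<bar>D\<bar> * (2 * r)" using r by auto
      have "\<bar>A * (a + r * px) + B * (r * py)\<bar> \<le> 2 * r * k"
        using bnd[OF ar(1), of A] bnd[OF rp(2), of B] nn unfolding kr by linarith
      then have "\<bar>x * (A * (a + r * px) + B * (r * py))\<bar> \<le> \<bar>x\<bar> * (2 * r * k)" by (rule bnd)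
      then show "x * (A * (a + r * px) + B * (r * py)) \<le> \<bar>x\<bar> * (2 * r * k)" by linarith
      have "\<bar>B * a + D * (b + r * py)\<bar> \<le> 2 * r * k"
        using bnd[OF ar(2), of D] bnd[OF abr(1), of B] nn unfolding kr by linarith
      then have "\<bar>y * (B * a + D * (b + r * py))\<bar> \<le> \<bar>y\<bar> * (2 * r * k)" by (rule bnd)
      then show "y * (B * a + D * (b + r * py)) \<le> \<bar>y\<bar> * (2 * r * k)" by linarith
    qed
    finally have 1: "(a\<^sup>2 * A + a * b * B + b\<^sup>2 * D) / 2
      \<le> r\<^sup>2 / 2 * (px\<^sup>2 * A + px * py * B + py\<^sup>2 * D) + (\<bar>x\<bar> * (r * k) + \<bar>y\<bar> * (r * k))"
      by (simp add: field_simps)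
    \<comment> \<open>This Young weight turns the bound \<open>xy2\<close> into exactly half of the
      linear loss.\<close>
    have pos: "g / (4 * r) > 0" using g r by simp
    have "\<bar>x\<bar> * (r * k) + \<bar>y\<bar> * (r * k)
      \<le> g / (4 * r) * (x\<^sup>2 + y\<^sup>2) + 2 * ((r * k)\<^sup>2 / (4 * (g / (4 * r))))"
      using young_quadratic[OF pos, of "\<bar>x\<bar>" "r * k"] young_quadratic[OF pos, of "\<bar>y\<bar>" "r * k"]
      by (simp only: power2_abs distrib_left)
    also have "g / (4 * r) * (x\<^sup>2 + y\<^sup>2) \<le> g / (4 * r) * (2 * r * (r - \<sigma>))"
      using xy2 pos by (intro mult_left_mono) auto
    also have "\<dots> = g / 2 * (r - \<sigma>)" using r by (simp add: field_simps)
    also have "2 * ((r * k)\<^sup>2 / (4 * (g / (4 * r)))) = 2 * k\<^sup>2 * r ^ 3 / g"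
      using r g by (simp add: field_simps power2_eq_square power3_eq_cube)
    finally show ?thesis using 1 by linarith
  qed
  have vert: "c * T \<le> g / 2 * (r - \<sigma>) + T\<^sup>2 * r ^ 3 / (8 * g)"
  proof -
    \<comment> \<open>The weight is matched to the bound \<open>c2\<close> below, so that the
      squared term costs the other half of the linear loss.\<close>
    have pos: "2 * g / r ^ 3 > 0" using g r by simp
    \<comment> \<open>The gauge constraint trades height for horizontal length: \<open>c\<close> can
      be large only if \<open>sqrt w\<close>, and hence \<open>\<sigma>\<close>, falls short of
      \<open>r\<close>.\<close>
    have "16 * c\<^sup>2 \<le> (r\<^sup>2 - w) * (r\<^sup>2 + w)"
      using ball unfolding w_def[symmetric] by (simp add: power4_eq_xxxx power2_eq_square algebra_simps)
    also have "\<dots> \<le> ((r - sqrt w) * (2 * r)) * (2 * r\<^sup>2)"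
    proof (intro mult_mono)
      have "r\<^sup>2 - w = (r - sqrt w) * (r + sqrt w)"
        using w by (simp add: power2_eq_square algebra_simps)
      also have "\<dots> \<le> (r - sqrt w) * (2 * r)" using wr by (intro mult_left_mono) auto
      finally show "r\<^sup>2 - w \<le> (r - sqrt w) * (2 * r)" .
    qed (use w r wr in auto)
    also have "\<dots> = 4 * r ^ 3 * (r - sqrt w)" by (simp add: power2_eq_square power3_eq_cube)
    also have "\<dots> \<le> 4 * r ^ 3 * (r - \<sigma>)" using \<sigma>w r by (intro mult_left_mono) auto
    finally have c2: "c\<^sup>2 \<le> r ^ 3 * (r - \<sigma>) / 4" by (simp add: mult.commute)
    have "c * T \<le> 2 * g / r ^ 3 * c\<^sup>2 + T\<^sup>2 / (4 * (2 * g / r ^ 3))"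
      by (rule young_quadratic[OF pos])
    also have "2 * g / r ^ 3 * c\<^sup>2 \<le> 2 * g / r ^ 3 * (r ^ 3 * (r - \<sigma>) / 4)"
      using c2 pos by (intro mult_left_mono) auto
    also have "\<dots> = g / 2 * (r - \<sigma>)" using r by (simp add: field_simps)
    also have "T\<^sup>2 / (4 * (2 * g / r ^ 3)) = T\<^sup>2 * r ^ 3 / (8 * g)" using r by simp
    finally show ?thesis by simp
  qed
  have lin: "a * gx + b * gy = g * \<sigma>" by (simp add: \<sigma>_def gxy algebra_simps)
  have L: "(gx\<^sup>2 * A + gx * gy * B + gy\<^sup>2 * D) / g\<^sup>2 = px\<^sup>2 * A + px * py * B + py\<^sup>2 * D"
    using g by (simp add: p power2_eq_square add_divide_distrib)
  have "(2 * k\<^sup>2 / g + T\<^sup>2 / (8 * g)) * r ^ 3 = 2 * k\<^sup>2 * r ^ 3 / g + T\<^sup>2 * r ^ 3 / (8 * g)"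
    by (simp add: distrib_right)
  moreover have "g * \<sigma> + (g / 2 * (r - \<sigma>) + g / 2 * (r - \<sigma>)) = r * g" by (simp add: algebra_simps)
  ultimately show ?thesis
    using quad vert unfolding lin L k_def[symmetric] by linarith
qed

section \<open>Expansion of the supremum\<close>

text \<open>The polynomial bound controls \<open>v\<close> from above at every point of the ball;
  evaluating \<open>v\<close> at one nearly extremal horizontal point bounds the supremum from
  below.\<close>

lemma SUP_heis_ball_expansion:
  fixes v :: "heis \<Rightarrow> real"
  assumes v: "heis_taylor2 v q gx gy A B D T" and nz: "gx\<^sup>2 + gy\<^sup>2 \<noteq> 0"
  shows "(\<lambda>r. (SUP p\<in>heis_ball r q. v p) - (v q + r * sqrt (gx\<^sup>2 + gy\<^sup>2)
      + r\<^sup>2 / 2 * ((gx\<^sup>2 * A + gx * gy * B + gy\<^sup>2 * D) / (gx\<^sup>2 + gy\<^sup>2))))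
    \<in> o[at_right 0](\<lambda>r. r\<^sup>2)"
proof (rule landau_o.smallI)
  fix \<epsilon> :: real assume \<epsilon>: "\<epsilon> > 0"
  define g where "g = sqrt (gx\<^sup>2 + gy\<^sup>2)"
  have "gx\<^sup>2 + gy\<^sup>2 > 0" using nz by (metis add_nonneg_nonneg less_eq_real_def zero_le_power2)
  then have g: "g > 0" and g2: "g\<^sup>2 = gx\<^sup>2 + gy\<^sup>2" by (auto simp: g_def)
  define L where "L = (gx\<^sup>2 * A + gx * gy * B + gy\<^sup>2 * D) / g\<^sup>2"
  \<comment> \<open>The first two summands are the cubic constant of the upper bound;
    \<open>g + \<bar>L\<bar>\<close> pays for shrinking the extremal point in the lower
    bound.\<close>
  define K where "K = 2 * (\<bar>A\<bar> + \<bar>B\<bar> + \<bar>D\<bar>)\<^sup>2 / g + T\<^sup>2 / (8 * g) + g + \<bar>L\<bar>"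
  have K: "g + \<bar>L\<bar> \<le> K" "K > 0"
  proof -
    show "g + \<bar>L\<bar> \<le> K" using g by (auto simp: K_def)
    then show "K > 0" using g by linarith
  qed
  define P where "P = (\<lambda>a b c. v q + a * gx + b * gy + (a\<^sup>2 * A + a * b * B + b\<^sup>2 * D) / 2 + c * T)"
  have "\<epsilon> / 2 > 0" using \<epsilon> by simp
  from v[unfolded heis_taylor2_def, THEN spec, THEN mp, OF this]
  have "\<exists>\<delta>>0. \<forall>\<rho><\<delta>. \<forall>(a, b, c)\<in>heis_box \<rho>. \<bar>v (heis_mult q (a, b, c)) - P a b c\<bar> \<le> \<epsilon> / 2 * \<rho>\<^sup>2"
    unfolding P_def .
  then obtain \<delta> where \<delta>: "\<delta> > 0" and
    taylor: "\<And>\<rho> a b c. \<rho> < \<delta> \<Longrightarrow> (a, b, c) \<in> heis_box \<rho> \<Longrightarrow>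
      \<bar>v (heis_mult q (a, b, c)) - P a b c\<bar> \<le> \<epsilon> / 2 * \<rho>\<^sup>2"
    by blast
  \<comment> \<open>Half of \<open>\<epsilon> * r\<^sup>2\<close> is spent on the Taylor error, half
    on the cubic terms through \<open>r < \<epsilon> / (2 * K)\<close>.\<close>
  have main: "\<bar>(SUP p\<in>heis_ball r q. v p) - (v q + r * g + r\<^sup>2 / 2 * L)\<bar> \<le> \<epsilon> * r\<^sup>2"
    if r: "0 < r" "r < min (min 1 \<delta>) (\<epsilon> / (2 * K))" for r
  proof -
    have "K * r \<le> \<epsilon> / 2" using r K by (simp add: field_simps)
    then have "K * r * r\<^sup>2 \<le> \<epsilon> / 2 * r\<^sup>2" by (rule mult_right_mono) simp
    then have Kr: "K * r ^ 3 \<le> \<epsilon> / 2 * r\<^sup>2" by (simp add: power3_eq_cube power2_eq_square)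
    have near: "\<bar>v (heis_mult q (a, b, c)) - P a b c\<bar> \<le> \<epsilon> / 2 * r\<^sup>2"
      if "(a\<^sup>2 + b\<^sup>2)\<^sup>2 + 16 * c\<^sup>2 < r ^ 4" for a b c
      using taylor koranyi_box(1)[OF that r(1)] r by simp
    have upper: "v p \<le> v q + r * g + r\<^sup>2 / 2 * L + \<epsilon> * r\<^sup>2" if "p \<in> heis_ball r q" for p
      using that
    proof (rule heis_ballE)
      fix a b c assume p: "p = heis_mult q (a, b, c)" and abc: "(a\<^sup>2 + b\<^sup>2)\<^sup>2 + 16 * c\<^sup>2 < r ^ 4"
      have "P a b c \<le> v q + r * g + r\<^sup>2 / 2 * L + (K - g - \<bar>L\<bar>) * r ^ 3"
        using quadratic_polynomial_gauge_ball_upper_bound[of gx gy r a b c A B D T, folded g_def, OF g r(1) abc]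
        by (simp add: P_def K_def L_def)
      moreover have "(K - g - \<bar>L\<bar>) * r ^ 3 \<le> K * r ^ 3"
        using r g by (intro mult_right_mono) auto
      ultimately show ?thesis using near[OF abc] Kr unfolding p by linarith
    qed
    \<comment> \<open>The extremal point lies on the boundary of the open ball; shrinking by \<open>r^3\<close> costs only \<open>O(r^3)\<close>.\<close>
    define t where "t = r - r ^ 3"
    have r3: "0 < r ^ 3" "r ^ 3 \<le> r"
      using r by (auto simp: power3_eq_cube mult_le_one)
    then have t: "0 \<le> t" "t < r" by (auto simp: t_def)
    let ?p = "heis_mult q (t * gx / g, t * gy / g, 0)"
    have tt: "(t * gx / g)\<^sup>2 + (t * gy / g)\<^sup>2 = t\<^sup>2"
      using g by (simp add: power_divide power_mult_distrib g2 flip: distrib_left add_divide_distrib) (use nz in auto)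
    have ball: "((t * gx / g)\<^sup>2 + (t * gy / g)\<^sup>2)\<^sup>2 + 16 * 0\<^sup>2 < r ^ 4"
      unfolding tt using power_strict_mono[OF t(2,1), of 4] by simp
    have in_ball: "?p \<in> heis_ball r q" unfolding heis_ball_iff using r(1) ball by (rule conjI)
    have "P (t * gx / g) (t * gy / g) 0 = v q + t * g + t\<^sup>2 / 2 * L"
    proof -
      have "t * gx / g * gx + t * gy / g * gy = t * (g\<^sup>2) / g"
        unfolding g2 by (simp add: power2_eq_square algebra_simps add_divide_distrib)
      then have "t * gx / g * gx + t * gy / g * gy = t * g" by (simp add: power2_eq_square)
      moreover have "((t * gx / g)\<^sup>2 * A + t * gx / g * (t * gy / g) * B + (t * gy / g)\<^sup>2 * D) / 2 = t\<^sup>2 / 2 * L"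
        unfolding L_def by (simp add: power2_eq_square add_divide_distrib algebra_simps)
      ultimately show ?thesis unfolding P_def by linarith
    qed
    \<comment> \<open>The real supremum dominates its members only for a set bounded above;
      \<open>upper\<close> supplies the bound.\<close>
    moreover have "v ?p \<le> (SUP p\<in>heis_ball r q. v p)"
      by (intro cSUP_upper[OF in_ball] bdd_aboveI2[OF upper])
    moreover have "t * g + t\<^sup>2 / 2 * L \<ge> r * g + r\<^sup>2 / 2 * L - K * r ^ 3"
    proof -
      have "(r\<^sup>2 - t\<^sup>2) / 2 * L = r ^ 3 * ((r + t) / 2 * L)"
        by (simp add: t_def power2_eq_square power3_eq_cube algebra_simps)
      also have "\<dots> \<le> r ^ 3 * \<bar>L\<bar>"
      proof (rule mult_left_mono)
        have "(r + t) / 2 * L \<le> \<bar>(r + t) / 2\<bar> * \<bar>L\<bar>" unfolding abs_mult[symmetric] by (rule abs_ge_self)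
        also have "\<dots> \<le> 1 * \<bar>L\<bar>" using t r by (intro mult_right_mono) auto
        finally show "(r + t) / 2 * L \<le> \<bar>L\<bar>" by simp
      qed (use r3 in simp)
      finally have "(r\<^sup>2 - t\<^sup>2) / 2 * L \<le> r ^ 3 * \<bar>L\<bar>" .
      moreover have "r ^ 3 * (g + \<bar>L\<bar>) \<le> r ^ 3 * K" using K r by (intro mult_left_mono) auto
      moreover have "t * g = r * g - r ^ 3 * g" by (simp add: t_def algebra_simps)
      moreover have "(r\<^sup>2 - t\<^sup>2) / 2 * L = r\<^sup>2 / 2 * L - t\<^sup>2 / 2 * L"
        by (simp add: left_diff_distrib diff_divide_distrib)
      ultimately show ?thesis by (simp add: distrib_left mult.commute[of K])
    qed
    moreover have "(SUP p\<in>heis_ball r q. v p) \<le> v q + r * g + r\<^sup>2 / 2 * L + \<epsilon> * r\<^sup>2"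
      using in_ball by (intro cSUP_least upper) blast
    ultimately show ?thesis using near[OF ball] Kr by linarith
  qed
  have "0 < min (min 1 \<delta>) (\<epsilon> / (2 * K))" using \<delta> \<epsilon> K by simp
  then show "\<forall>\<^sub>F r in at_right 0. norm ((SUP p\<in>heis_ball r q. v p) - (v q + r * sqrt (gx\<^sup>2 + gy\<^sup>2)
      + r\<^sup>2 / 2 * ((gx\<^sup>2 * A + gx * gy * B + gy\<^sup>2 * D) / (gx\<^sup>2 + gy\<^sup>2)))) \<le> \<epsilon> * norm (r\<^sup>2)"
    unfolding eventually_at_right_field g_def[symmetric]
    unfolding g2[symmetric] L_def[symmetric]
    using main by (intro exI[of _ "min (min 1 \<delta>) (\<epsilon> / (2 * K))"]) auto
qed

section \<open>The sub-Laplacian in coordinates and the mean value expansion\<close>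

lemma norm_vector_2: "norm (vector [x, y] :: real ^ 2) = sqrt (x\<^sup>2 + y\<^sup>2)"
  by (simp add: norm_vec_def L2_set_def sum_2)

text \<open>The tensor square is quadratic and symmetric, so the normalization becomes one division
  by the squared norm and the mixed derivatives enter only through their sum. At a zero gradient
  both sides are 0, as division by 0 gives 0.\<close>

lemma inf_sub_Laplacian_eq:
  "inf_sub_Laplacian v q = ((dX v q)\<^sup>2 * dX (dX v) q + dX v q * dY v q * (dX (dY v) q + dY (dX v) q)
     + (dY v q)\<^sup>2 * dY (dY v) q) / ((dX v q)\<^sup>2 + (dY v q)\<^sup>2)"
proof -
  have n: "norm (horiz_grad v q) ^ 2 = (dX v q)\<^sup>2 + (dY v q)\<^sup>2"
    by (simp add: horiz_grad_def norm_vector_2)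
  have "inf_sub_Laplacian v q = (dX (dX v) q * (dX v q)\<^sup>2 + dX (dY v) q * (dX v q * dY v q)
      + dY (dX v) q * (dY v q * dX v q) + dY (dY v) q * (dY v q)\<^sup>2) / norm (horiz_grad v q) ^ 2"
    unfolding inf_sub_Laplacian_def
    by (simp add: horiz_hess_def tensor_square_def inner_vec_def sum_2 power2_eq_square add_divide_distrib
        divide_inverse algebra_simps) (simp add: horiz_grad_def algebra_simps)
  then show ?thesis unfolding n by (simp add: algebra_simps)
qed

theorem theorem3p1:
  fixes v :: "heis \<Rightarrow> real" and q :: heis
  assumes "heis_C2 v"
    and "horiz_grad v q \<noteq> 0"
  shows "(\<lambda>r::real. 1 / 2 * ((INF p\<in>heis_ball r q. v p) + (SUP p\<in>heis_ball r q. v p))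
            - (v q + r\<^sup>2 / 2 * inf_sub_Laplacian v q))
         \<in> o[at_right 0](\<lambda>r. r\<^sup>2)"
proof -
  define gx gy where gxy: "gx = dX v q" "gy = dY v q"
  define A B D T where ABDT: "A = dX (dX v) q" "B = dX (dY v) q + dY (dX v) q" "D = dY (dY v) q"
    "T = dX (dY v) q - dY (dX v) q"
  have taylor: "heis_taylor2 v q gx gy A B D T"
    unfolding gxy ABDT using heis_C2_taylor[OF assms(1)] .
  have "norm (horiz_grad v q) \<noteq> 0" using assms(2) by simp
  then have nz: "gx\<^sup>2 + gy\<^sup>2 \<noteq> 0" by (simp add: horiz_grad_def norm_vector_2 gxy)
  define L where "L = (gx\<^sup>2 * A + gx * gy * B + gy\<^sup>2 * D) / (gx\<^sup>2 + gy\<^sup>2)"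
  have L: "inf_sub_Laplacian v q = L" by (simp add: inf_sub_Laplacian_eq L_def gxy ABDT)
  define S where "S = (\<lambda>u r. SUP p\<in>heis_ball r q. u p :: real)"
  have "(\<lambda>r. S v r - (v q + r * sqrt (gx\<^sup>2 + gy\<^sup>2) + r\<^sup>2 / 2 * L)) \<in> o[at_right 0](\<lambda>r. r\<^sup>2)"
    unfolding S_def L_def by (rule SUP_heis_ball_expansion[OF taylor nz])
  moreover have "(\<lambda>r. S (\<lambda>p. - v p) r - (- v q + r * sqrt (gx\<^sup>2 + gy\<^sup>2) + r\<^sup>2 / 2 * (- L)))
      \<in> o[at_right 0](\<lambda>r. r\<^sup>2)"
  proof -
    \<comment> \<open>The gradient enters quadratically, so only the sign of the Hessian
      survives.\<close>
    have "((- gx)\<^sup>2 * - A + - gx * - gy * - B + (- gy)\<^sup>2 * - D) / ((- gx)\<^sup>2 + (- gy)\<^sup>2) = - L"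
      by (simp add: L_def add_divide_distrib diff_divide_distrib)
    moreover have "(- gx)\<^sup>2 + (- gy)\<^sup>2 \<noteq> 0" using nz by simp
    note SUP_heis_ball_expansion[OF heis_taylor2_uminus[OF taylor] this]
    ultimately show ?thesis unfolding S_def by (simp only: power2_minus)
  qed
  \<comment> \<open>In the difference the terms \<open>r * sqrt (gx\<^sup>2 + gy\<^sup>2)\<close>
    cancel, while \<open>v q\<close> and the \<open>L\<close> terms double.\<close>
  ultimately have "(\<lambda>r. 1 / 2 * ((S v r - (v q + r * sqrt (gx\<^sup>2 + gy\<^sup>2) + r\<^sup>2 / 2 * L))
      - (S (\<lambda>p. - v p) r - (- v q + r * sqrt (gx\<^sup>2 + gy\<^sup>2) + r\<^sup>2 / 2 * (- L)))))
      \<in> o[at_right 0](\<lambda>r. r\<^sup>2)"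
    by (subst landau_o.small.cmult_in_iff) (simp, rule sum_in_smallo)
  moreover have "(INF p\<in>heis_ball r q. v p) = - S (\<lambda>p. - v p) r" for r
    by (simp add: S_def Inf_real_def image_image)
  ultimately show ?thesis
    unfolding L by (simp add: S_def algebra_simps)
qed

end
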